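(* Assume the $k$-th layer of a neural network is a nonlinear layer with (monotonically increasing) activation function $\phi_k:\mathbb{R}\to\mathbb{R}$, applied elementwise. Given an input set $\mathcal{H}_{k-1}=\langle c_{k-1},G_{k-1}\rangle$ with $G_{k-1}\in\mathbb{R}^{n_{k-1}\times p}$ and a gradient set $\mathcal{G}_k=\langle c'_k,G'_k\rangle=\nabla_{\mathcal{H}_k}E(t,\mathcal{Y})$, the gradient set $\mathcal{G}_{k-1}=\langle c'_{k-1},G'_{k-1}\rangle=\nabla_{\mathcal{H}_{k-1}}E(t,\mathcal{Y})$ is computed for each dimension $i\in\{1,\dots,n_k\}$ as $$\begin{aligned}\mathcal{G}_{k-1(i)}={}& m_{k(i)}\,\mathcal{G}_{k(i)}+\Big(c'_{k(i)}\,c_{k-1(i)}+G'_{k(i,[p])}\,G_{k-1(i,\cdot)}^{\top}\Big)\nabla_{\mathcal{H}_{k-1(i)}}m_{k(i)}\\&+\tfrac12\big(c'_{k(i)}+G'_{k(i,p+i)}\big)\nabla_{\mathcal{H}_{k-1(i)}}\overline{e}_{k(i)}+\tfrac12\big(c'_{k(i)}-G'_{k(i,p+i)}\big)\nabla_{\mathcal{H}_{k-1(i)}}\underline{e}_{k(i)} .\end{aligned}$$ The operation $\mathcal{G}_{k-1}=\mathtt{backpropEnclose}(\phi_k,\mathcal{G}_k)$ denotes this computation of the gradient set of an image enclosure.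
   Context: Zonotopes $\langle c,G\rangle=\{c+\sum_j G_{(\cdot,j)}\beta_{(j)}\mid\beta_{(j)}\in[-1,1]\}$ are handled via center $c$ and generator matrix $G$. Scalar multiplication and "$+$" of zonotopes are entrywise: $\langle c_1,G_1\rangle+\langle c_2,G_2\rangle=\langle c_1+c_2,G_1+G_2\rangle$. Projection to dimension $i$: $\langle c,G\rangle_{(i)}=\langle c_{(i)},G_{(i,\cdot)}\rangle$; $[p]=\{1,\dots,p\}$, and $G_{(i,[p])}$ is the row vector of the first $p$ entries of row $i$. The gradient of a scalar function $f$ with respect to a zonotope is $\nabla_{\langle c,G\rangle}f:=\langle\nabla_cf,\nabla_Gf\rangle$ (entrywise partial derivatives); $\nabla_{\mathcal{H}_{(i)}}f$ is the same with respect to $(c_{(i)},G_{(i,\cdot)})$. Network and loss: a network with $\kappa$ layers propagates an input zonotope $\mathcal{H}_0$ to $\mathcal{H}_1,\dots,\mathcal{H}_\kappa=\mathcal{Y}=\langle c_\kappa,G_\kappa\rangle\subset\mathbb{R}^{n_\kappa}$, with $\mathcal{H}_k=\langle W_kc_{k-1}+b_k,W_kG_{k-1}\rangle$ for a linear layer (weights $W_k$, bias $b_k$) and $\mathcal{H}_k=\mathtt{enclose}(\phi_k,\mathcal{H}_{k-1})$ for a nonlinear layer ($n_k=n_{k-1}$). The set-based loss for a target $t\in\mathbb{R}^{n_\kappa}$ is $E(t,\mathcal{Y})=(1-\tau)L(t,c_\kappa)+\frac{\tau}{\epsilon}\|\mathcal{Y}\|_F$, where $L$ is a loss function, $\tau\in[0,1]$,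 $\epsilon>0$, and $\|\mathcal{Y}\|_F=\frac1{n_\kappa}\sqrt{\sum_{i,j}G_{\kappa(i,j)}^2}$. Image enclosure: with $l_{k-1}=c_{k-1}-|G_{k-1}|\mathbf{1}$ and $u_{k-1}=c_{k-1}+|G_{k-1}|\mathbf{1}$ (entrywise absolute value, $\mathbf{1}$ the all-ones vector), put for each $i$: $m_{k(i)}=\frac{\phi_k(u_{k-1(i)})-\phi_k(l_{k-1(i)})}{u_{k-1(i)}-l_{k-1(i)}}$, and let $\underline{e}_{k(i)}$ and $\overline{e}_{k(i)}$ be the minimum and maximum of $\phi_k(x)-m_{k(i)}x$ over $x\in[l_{k-1(i)},u_{k-1(i)}]$. Then $\mathtt{enclose}(\phi_k,\mathcal{H}_{k-1})=\langle c_k,G_k\rangle$ with $c_k=\mathrm{diag}(m_k)\,c_{k-1}+\frac12(\overline{e}_k+\underline{e}_k)$ and $G_k=[\,\mathrm{diag}(m_k)\,G_{k-1}\ \ \tfrac12\mathrm{diag}(\overline{e}_k-\underline{e}_k)\,]\in\mathbb{R}^{n_k\times(p+n_k)}$. Hence $G'_k$ has $p+n_k$ columns and $\mathcal{G}_{k-1}$ has $p$ generators; in the summand $m_{k(i)}\,\mathcal{G}_{k(i)}$ the set $\mathcal{G}_{k(i)}$ is to be read as $\langle c'_{k(i)},G'_{k(i,[p])}\rangle$.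
   Formalization: The formal theorem additionally assumes that E, as a function of H_k, is totally differentiable at H_k (existence of the partial derivatives alone does not suffice), and that m_k(i) and both error bounds have partial derivatives with respect to H_{k-1(i)}. *)

theory Defs
  imports "HOL-Analysis.Derivative" "Jordan_Normal_Form.Matrix"
begin

unbundle no inner_syntax

text \<open>
  The zonotope \<open>{c + G \<beta> | \<beta> \<in> [-1,1]\<^sup>q}\<close> is represented by its center \<open>c\<close> and generator
  matrix \<open>G\<close>. All indices start from 0, except that layers are numbered from 1.
\<close>

datatype zonotope = Zonotope (center: "real vec") (gens: "real mat")

definition carrier_zono :: "nat \<Rightarrow> nat \<Rightarrow> zonotope set" where
  "carrier_zono n q = {Z. center Z \<in> carrier_vec n \<and> gens Z \<in> carrier_mat n q}"

text \<open>Addition is entrywise; it is not the Minkowski sum.\<close>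

instantiation zonotope :: "{plus, scaleR}"
begin

definition plus_zonotope :: "zonotope \<Rightarrow> zonotope \<Rightarrow> zonotope" where
  "X + Y = Zonotope (center X + center Y) (gens X + gens Y)"

definition scaleR_zonotope :: "real \<Rightarrow> zonotope \<Rightarrow> zonotope" where
  "a *\<^sub>R X = Zonotope (a \<cdot>\<^sub>v center X) (a \<cdot>\<^sub>m gens X)"

instance ..

end

text \<open>A projection is again a zonotope, with a center of dimension 1 and a one-row generator matrix.\<close>

definition zproj :: "nat \<Rightarrow> zonotope \<Rightarrow> zonotope" where
  "zproj i Z = Zonotope (vec 1 (\<lambda>_. center Z $ i)) (mat_of_row (row (gens Z) i))"

definition zproj_first :: "nat \<Rightarrow> nat \<Rightarrow> zonotope \<Rightarrow> zonotope" where
  "zproj_first p i Z =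
     Zonotope (vec 1 (\<lambda>_. center Z $ i)) (mat_of_row (vec_first (row (gens Z) i) p))"


subsection \<open>Gradients with respect to a zonotope\<close>

definition set_center :: "nat \<Rightarrow> real \<Rightarrow> zonotope \<Rightarrow> zonotope" where
  "set_center i x Z =
     Zonotope (vec (dim_vec (center Z)) (\<lambda>i'. if i' = i then x else center Z $ i')) (gens Z)"

definition set_gen :: "nat \<Rightarrow> nat \<Rightarrow> real \<Rightarrow> zonotope \<Rightarrow> zonotope" where
  "set_gen i j x Z =
     Zonotope (center Z)
       (mat (dim_row (gens Z)) (dim_col (gens Z))
          (\<lambda>(i', j'). if i' = i \<and> j' = j then x else gens Z $$ (i', j')))"

definition zgrad :: "(zonotope \<Rightarrow> real) \<Rightarrow> zonotope \<Rightarrow> zonotope" where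
  "zgrad f Z =
     Zonotope
       (vec (dim_vec (center Z)) (\<lambda>i. deriv (\<lambda>x. f (set_center i x Z)) (center Z $ i)))
       (mat (dim_row (gens Z)) (dim_col (gens Z))
          (\<lambda>(i, j). deriv (\<lambda>x. f (set_gen i j x Z)) (gens Z $$ (i, j))))"

definition zgrad_row :: "nat \<Rightarrow> (zonotope \<Rightarrow> real) \<Rightarrow> zonotope \<Rightarrow> zonotope" where
  "zgrad_row i f Z = zproj i (zgrad f Z)"

text \<open>Existence of all partial derivatives collected in \<^const>\<open>zgrad_row\<close>.\<close>

definition has_zgrad_row :: "nat \<Rightarrow> (zonotope \<Rightarrow> real) \<Rightarrow> zonotope \<Rightarrow> bool" where
  "has_zgrad_row i f Z \<longleftrightarrow>
     (\<lambda>x. f (set_center i x Z)) field_differentiable at (center Z $ i) \<and>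
     (\<forall>j<dim_col (gens Z).
        (\<lambda>x. f (set_gen i j x Z)) field_differentiable at (gens Z $$ (i, j)))"

text \<open>
  Total (Frechet) differentiability at \<open>Z\<close> among zonotopes of the same shape, with the Euclidean
  structure of all entries. It is spelled out because the shapes are not types.
\<close>

definition zinner :: "zonotope \<Rightarrow> zonotope \<Rightarrow> real" where
  "zinner X Y =
     (\<Sum>i<dim_vec (center X). center X $ i * center Y $ i) +
     (\<Sum>i<dim_row (gens X). \<Sum>j<dim_col (gens X). gens X $$ (i, j) * gens Y $$ (i, j))"

definition znorm :: "zonotope \<Rightarrow> real" where
  "znorm X = sqrt (zinner X X)"

definition zdifferentiable :: "(zonotope \<Rightarrow> real) \<Rightarrow> zonotope \<Rightarrow> bool" where
  "zdifferentiable f Z \<longleftrightarrow>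
     (let S = carrier_zono (dim_vec (center Z)) (dim_col (gens Z)) in
      \<exists>D\<in>S. \<forall>\<epsilon>>0. \<exists>\<delta>>0. \<forall>V\<in>S. znorm V < \<delta> \<longrightarrow>
        \<bar>f (Z + V) - f Z - zinner D V\<bar> \<le> \<epsilon> * znorm V)"


subsection \<open>Image enclosure\<close>

definition lower_bounds :: "zonotope \<Rightarrow> real vec" where
  "lower_bounds Z = center Z - map_mat abs (gens Z) *\<^sub>v vec (dim_col (gens Z)) (\<lambda>_. 1)"

definition upper_bounds :: "zonotope \<Rightarrow> real vec" where
  "upper_bounds Z = center Z + map_mat abs (gens Z) *\<^sub>v vec (dim_col (gens Z)) (\<lambda>_. 1)"

text \<open>If both bounds coincide, this is 0 because of \<open>x / 0 = 0\<close>.\<close>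

definition slope :: "(real \<Rightarrow> real) \<Rightarrow> nat \<Rightarrow> zonotope \<Rightarrow> real" where
  "slope \<phi> i Z =
     (\<phi> (upper_bounds Z $ i) - \<phi> (lower_bounds Z $ i)) / (upper_bounds Z $ i - lower_bounds Z $ i)"

definition lower_error :: "(real \<Rightarrow> real) \<Rightarrow> nat \<Rightarrow> zonotope \<Rightarrow> real" where
  "lower_error \<phi> i Z =
     (LEAST y. y \<in> (\<lambda>x. \<phi> x - slope \<phi> i Z * x) ` {lower_bounds Z $ i .. upper_bounds Z $ i})"

definition upper_error :: "(real \<Rightarrow> real) \<Rightarrow> nat \<Rightarrow> zonotope \<Rightarrow> real" where
  "upper_error \<phi> i Z =
     (GREATEST y. y \<in> (\<lambda>x. \<phi> x - slope \<phi> i Z * x) ` {lower_bounds Z $ i .. upper_bounds Z $ i})"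

definition append_cols :: "real mat \<Rightarrow> real mat \<Rightarrow> real mat" where
  "append_cols A B = four_block_mat A B (0\<^sub>m 0 (dim_col A)) (0\<^sub>m 0 (dim_col B))"

definition enclose :: "(real \<Rightarrow> real) \<Rightarrow> zonotope \<Rightarrow> zonotope" where
  "enclose \<phi> Z =
     (let n = dim_vec (center Z);
          m = (\<lambda>i. slope \<phi> i Z);
          e_hi = (\<lambda>i. upper_error \<phi> i Z);
          e_lo = (\<lambda>i. lower_error \<phi> i Z)
      in Zonotope
           (mat_diag n m *\<^sub>v center Z + (1/2) \<cdot>\<^sub>v vec n (\<lambda>i. e_hi i + e_lo i))
           (append_cols (mat_diag n m * gens Z) ((1/2) \<cdot>\<^sub>m mat_diag n (\<lambda>i. e_hi i - e_lo i))))"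


subsection \<open>Networks and set-based loss\<close>

datatype layer = Linear "real mat" "real vec" | Nonlinear "real \<Rightarrow> real"

fun layer_dims :: "nat \<Rightarrow> nat \<Rightarrow> layer \<Rightarrow> bool" where
  "layer_dims n_in n_out (Linear W b) \<longleftrightarrow> W \<in> carrier_mat n_out n_in \<and> b \<in> carrier_vec n_out"
| "layer_dims n_in n_out (Nonlinear \<phi>) \<longleftrightarrow> n_out = n_in"

fun layer_image :: "layer \<Rightarrow> zonotope \<Rightarrow> zonotope" where
  "layer_image (Linear W b) Z = Zonotope (W *\<^sub>v center Z + b) (W * gens Z)"
| "layer_image (Nonlinear \<phi>) Z = enclose \<phi> Z"

text \<open>Layers \<open>j+1, \<dots>, k\<close>, mapping the set after layer \<open>j\<close> to the set after layer \<open>k\<close>.\<close>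

definition propagate :: "(nat \<Rightarrow> layer) \<Rightarrow> nat \<Rightarrow> nat \<Rightarrow> zonotope \<Rightarrow> zonotope" where
  "propagate N j k = fold (\<lambda>i. layer_image (N i)) [Suc j..<Suc k]"

definition frob_norm :: "zonotope \<Rightarrow> real" where
  "frob_norm Z =
     1 / real (dim_vec (center Z)) *
     sqrt (\<Sum>i<dim_row (gens Z). \<Sum>j<dim_col (gens Z). (gens Z $$ (i, j))\<^sup>2)"

definition set_loss ::
    "(real vec \<Rightarrow> real vec \<Rightarrow> real) \<Rightarrow> real \<Rightarrow> real \<Rightarrow> real vec \<Rightarrow> zonotope \<Rightarrow> real" where
  "set_loss L \<tau> \<epsilon> t Y = (1 - \<tau>) * L t (center Y) + \<tau> / \<epsilon> * frob_norm Y"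

end

theory Submission
  imports Defs
begin

text \<open>
  The loss as a function of the previous set is the loss as a function of the next set composed
  with the enclosure. Perturbing one entry of row \<open>i\<close> of the input moves only row \<open>i\<close> of the
  enclosure, along a curve that is differentiable because \<open>m\<close> and the two error bounds are, so the
  chain rule for a totally differentiable loss yields the partial derivative. Collecting the terms
  that contain the derivatives of \<open>m\<close> and of the error bounds gives the formula.
\<close>

subsection \<open>Chain rule along curves of zonotopes\<close>

lemma carrier_zono_iff:
  "Z \<in> carrier_zono n q \<longleftrightarrow>
    dim_vec (center Z) = n \<and> dim_row (gens Z) = n \<and> dim_col (gens Z) = q"
  unfolding carrier_zono_def by (blast intro: carrier_vecI carrier_matI dest: carrier_vecD carrier_matD)

lemma carrier_zonoD:
  assumes "Z \<in> carrier_zono n q"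
  shows "dim_vec (center Z) = n" "dim_row (gens Z) = n" "dim_col (gens Z) = q"
  using assms by (simp_all add: carrier_zono_iff)

lemma zonotope_eqI:
  assumes "X \<in> carrier_zono n q" "Y \<in> carrier_zono n q"
    and "\<And>i. i < n \<Longrightarrow> center X $ i = center Y $ i"
    and "\<And>i j. i < n \<Longrightarrow> j < q \<Longrightarrow> gens X $$ (i, j) = gens Y $$ (i, j)"
  shows "X = Y"
  using assms by (intro zonotope.expand conjI eq_vecI eq_matI) (auto simp: carrier_zono_def)

lemma zinner_carrier:
  assumes "X \<in> carrier_zono n q"
  shows "zinner X Y =
    (\<Sum>i<n. center X $ i * center Y $ i) + (\<Sum>i<n. \<Sum>j<q. gens X $$ (i, j) * gens Y $$ (i, j))"
  using carrier_zonoD[OF assms] by (simp add: zinner_def)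

text \<open>This is the body of \<open>zdifferentiable\<close> with the witness \<open>D\<close> and
  the shape as parameters, so that the derivative can be named and later identified with the
  gradient.\<close>

definition has_zderivative :: "(zonotope \<Rightarrow> real) \<Rightarrow> zonotope \<Rightarrow> nat \<Rightarrow> nat \<Rightarrow> zonotope \<Rightarrow> bool" where
  "has_zderivative f D n q Z \<longleftrightarrow> D \<in> carrier_zono n q \<and>
     (\<forall>\<epsilon>>0. \<exists>\<delta>>0. \<forall>V\<in>carrier_zono n q. znorm V < \<delta> \<longrightarrow>
        \<bar>f (Z + V) - f Z - zinner D V\<bar> \<le> \<epsilon> * znorm V)"

text \<open>The error of the linear approximation is small relative to the norm of the increment,
  and that norm divided by \<open>\<bar>x - x0\<bar>\<close> stays bounded because it converges to
  the norm of the velocity. With finitely many entries, entrywise differentiability of the curve at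
  \<open>x0\<close> suffices.\<close>

lemma has_zderivative_chain:
  assumes D: "has_zderivative f D n q (\<gamma> x0)"
    and \<gamma>: "\<And>x. \<gamma> x \<in> carrier_zono n q"
    and dc: "\<And>i. i < n \<Longrightarrow> ((\<lambda>x. center (\<gamma> x) $ i) has_field_derivative dc i) (at x0)"
    and dg: "\<And>i j. i < n \<Longrightarrow> j < q \<Longrightarrow>
      ((\<lambda>x. gens (\<gamma> x) $$ (i, j)) has_field_derivative dg i j) (at x0)"
  shows "((\<lambda>x. f (\<gamma> x)) has_field_derivative
      (\<Sum>i<n. center D $ i * dc i) + (\<Sum>i<n. \<Sum>j<q. gens D $$ (i, j) * dg i j)) (at x0)"
proof -
  define V where "V x = Zonotope (vec n (\<lambda>i. center (\<gamma> x) $ i - center (\<gamma> x0) $ i))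
    (mat n q (\<lambda>(i, j). gens (\<gamma> x) $$ (i, j) - gens (\<gamma> x0) $$ (i, j)))" for x
  define qc where "qc x i = (center (\<gamma> x) $ i - center (\<gamma> x0) $ i) / (x - x0)" for x i
  define qg where "qg x i j = (gens (\<gamma> x) $$ (i, j) - gens (\<gamma> x0) $$ (i, j)) / (x - x0)" for x i j
  have Dc: "D \<in> carrier_zono n q" using D by (simp add: has_zderivative_def)
  have V: "V x \<in> carrier_zono n q" for x by (simp add: V_def carrier_zono_def)
  have V_entries: "center (V x) $ i = qc x i * (x - x0)"
      "j < q \<Longrightarrow> gens (V x) $$ (i, j) = qg x i j * (x - x0)" if "x \<noteq> x0" "i < n" for x i j
    using that by (auto simp: V_def qc_def qg_def)
  have add: "\<gamma> x0 + V x = \<gamma> x" for x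
  proof (rule zonotope_eqI[of _ n q])
    show "\<gamma> x0 + V x \<in> carrier_zono n q"
      using V[of x] \<gamma>[of x0] by (simp add: plus_zonotope_def carrier_zono_def)
  qed (simp_all add: \<gamma> plus_zonotope_def V_def)
  have qc: "((\<lambda>x. qc x i) \<longlongrightarrow> dc i) (at x0)" if "i < n" for i
    using dc[OF that] by (simp add: has_field_derivative_iff qc_def)
  have qg: "((\<lambda>x. qg x i j) \<longlongrightarrow> dg i j) (at x0)" if "i < n" "j < q" for i j
    using dg[OF that] by (simp add: has_field_derivative_iff qg_def)
  \<comment> \<open>\<open>Q x\<close> is \<open>D\<close> applied to the difference quotient of the
    curve and \<open>R x\<close> is the norm of that quotient; \<open>K\<close> is the norm of the
    velocity, the limit of \<open>R\<close>.\<close>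
  define Q where "Q x = (\<Sum>i<n. center D $ i * qc x i) + (\<Sum>i<n. \<Sum>j<q. gens D $$ (i, j) * qg x i j)" for x
  define R where "R x = sqrt ((\<Sum>i<n. (qc x i)\<^sup>2) + (\<Sum>i<n. \<Sum>j<q. (qg x i j)\<^sup>2))" for x
  define K where "K = sqrt ((\<Sum>i<n. (dc i)\<^sup>2) + (\<Sum>i<n. \<Sum>j<q. (dg i j)\<^sup>2))"
  have Q: "(Q \<longlongrightarrow> (\<Sum>i<n. center D $ i * dc i) + (\<Sum>i<n. \<Sum>j<q. gens D $$ (i, j) * dg i j)) (at x0)"
    unfolding Q_def by (intro tendsto_intros qc qg) auto
  have R: "(R \<longlongrightarrow> K) (at x0)"
    unfolding R_def K_def by (intro tendsto_intros qc qg) auto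
  have zinner_V: "zinner D (V x) = Q x * (x - x0)" if "x \<noteq> x0" for x
    unfolding zinner_carrier[OF Dc] Q_def
    by (simp add: V_entries[OF that] distrib_right sum_distrib_right mult.assoc)
  have znorm_V: "znorm (V x) = R x * \<bar>x - x0\<bar>" if "x \<noteq> x0" for x
  proof -
    have "zinner (V x) (V x)
        = ((\<Sum>i<n. (qc x i)\<^sup>2) + (\<Sum>i<n. \<Sum>j<q. (qg x i j)\<^sup>2)) * (x - x0)\<^sup>2"
      unfolding zinner_carrier[OF V]
      by (simp add: V_entries[OF that] distrib_right sum_distrib_right power_mult_distrib flip: power2_eq_square)
    then show ?thesis by (simp add: znorm_def R_def real_sqrt_mult)
  qed
  \<comment> \<open>The increments shrink to 0, so they eventually enter the
    \<open>\<delta>\<close>-ball of the total derivative.\<close>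
  have "((\<lambda>x. R x * \<bar>x - x0\<bar>) \<longlongrightarrow> K * \<bar>x0 - x0\<bar>) (at x0)"
    by (intro tendsto_intros R)
  then have znorm_0: "((\<lambda>x. R x * \<bar>x - x0\<bar>) \<longlongrightarrow> 0) (at x0)" by simp
  have K0: "K \<ge> 0" unfolding K_def by (simp add: sum_nonneg)
  have "((\<lambda>x. (f (\<gamma> x) - f (\<gamma> x0)) / (x - x0) - Q x) \<longlongrightarrow> 0) (at x0)"
  proof (rule tendstoI)
    fix e :: real assume e: "e > 0"
    \<comment> \<open>Near \<open>x0\<close> we have \<open>R x < K + 1\<close>, so the error after
      division by \<open>\<bar>x - x0\<bar>\<close> is at most \<open>\<eta> * (K + 1)\<close>. The
      denominator \<open>K + 2\<close> makes this strictly less than \<open>e\<close>.\<close>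
    define \<eta> where "\<eta> = e / (K + 2)"
    have \<eta>: "\<eta> > 0" "\<eta> * (K + 1) < e" using e K0 by (auto simp: \<eta>_def field_simps)
    obtain \<delta> where \<delta>: "\<delta> > 0" "\<And>U. U \<in> carrier_zono n q \<Longrightarrow> znorm U < \<delta> \<Longrightarrow>
        \<bar>f (\<gamma> x0 + U) - f (\<gamma> x0) - zinner D U\<bar> \<le> \<eta> * znorm U"
      using D \<eta>(1) unfolding has_zderivative_def by blast
    have ev1: "\<forall>\<^sub>F x in at x0. R x * \<bar>x - x0\<bar> < \<delta>"
      using znorm_0 \<delta>(1) by (rule order_tendstoD)
    have ev2: "\<forall>\<^sub>F x in at x0. R x < K + 1"
      using R by (rule order_tendstoD) simp
    show "\<forall>\<^sub>F x in at x0. dist ((f (\<gamma> x) - f (\<gamma> x0)) / (x - x0) - Q x) 0 < e"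
      using ev1 ev2 eventually_neq_at_within[of x0 x0 UNIV]
    proof eventually_elim
      case (elim x)
      have "\<bar>f (\<gamma> x) - f (\<gamma> x0) - Q x * (x - x0)\<bar> \<le> \<eta> * (R x * \<bar>x - x0\<bar>)"
        using \<delta>(2)[OF V[of x]] elim by (simp add: add zinner_V znorm_V)
      then have "\<bar>f (\<gamma> x) - f (\<gamma> x0) - Q x * (x - x0)\<bar> / \<bar>x - x0\<bar> \<le> \<eta> * R x"
        using elim by (simp add: field_simps)
      also have "\<dots> \<le> \<eta> * (K + 1)" using elim \<eta> by simp
      also have "\<dots> < e" by (rule \<eta>)
      finally have "\<bar>f (\<gamma> x) - f (\<gamma> x0) - Q x * (x - x0)\<bar> / \<bar>x - x0\<bar> < e" .
      moreover have "(f (\<gamma> x) - f (\<gamma> x0)) / (x - x0) - Q x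
          = (f (\<gamma> x) - f (\<gamma> x0) - Q x * (x - x0)) / (x - x0)"
        using elim by (simp add: field_simps)
      ultimately show ?case by (simp add: abs_divide)
    qed
  qed
  from tendsto_add[OF this Q] show ?thesis by (simp add: has_field_derivative_iff)
qed

section \<open>One-entry perturbations and uniqueness of the total derivative\<close>

lemma set_center_carrier [simp]:
  "set_center i x Z \<in> carrier_zono n q \<longleftrightarrow> Z \<in> carrier_zono n q"
  by (simp add: set_center_def carrier_zono_iff)

lemma set_gen_carrier [simp]:
  "set_gen i j x Z \<in> carrier_zono n q \<longleftrightarrow> Z \<in> carrier_zono n q"
  by (simp add: set_gen_def carrier_zono_iff)

lemma set_center_index [simp]:
  "i' < dim_vec (center Z) \<Longrightarrow> center (set_center i x Z) $ i' = (if i' = i then x else center Z $ i')"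
  "gens (set_center i x Z) = gens Z"
  by (simp_all add: set_center_def)

lemma set_gen_index [simp]:
  "center (set_gen i j x Z) = center Z"
  "i' < dim_row (gens Z) \<Longrightarrow> j' < dim_col (gens Z) \<Longrightarrow>
    gens (set_gen i j x Z) $$ (i', j') = (if i' = i \<and> j' = j then x else gens Z $$ (i', j'))"
  by (simp_all add: set_gen_def)

lemma set_center_same: "i < dim_vec (center Z) \<Longrightarrow> set_center i (center Z $ i) Z = Z"
  by (intro zonotope.expand) (auto simp: set_center_def)

lemma set_gen_same: "set_gen i j (gens Z $$ (i, j)) Z = Z"
  by (intro zonotope.expand) (auto simp: set_gen_def intro!: eq_matI)

text \<open>A curve that moves a single entry at unit speed has a Kronecker delta as velocity, so
  the chain rule reads off the corresponding entry of \<open>D\<close>. Thus each partial derivative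
  is an entry of \<open>D\<close>.\<close>

lemma has_zderivative_imp_zgrad:
  assumes D: "has_zderivative f D n q Z" and Z: "Z \<in> carrier_zono n q"
  shows "zgrad f Z = D"
proof -
  note dims = carrier_zonoD[OF Z]
  have Dc: "D \<in> carrier_zono n q" using D by (simp add: has_zderivative_def)
  have c: "deriv (\<lambda>x. f (set_center i x Z)) (center Z $ i) = center D $ i" if i: "i < n" for i
  proof -
    have "((\<lambda>x. f (set_center i x Z)) has_field_derivative
      (\<Sum>i'<n. center D $ i' * (if i' = i then 1 else 0)) + (\<Sum>i'<n. \<Sum>j<q. gens D $$ (i', j) * 0))
      (at (center Z $ i))"
      using D Z i
      by (intro has_zderivative_chain)
        (auto simp: set_center_same dims)
    then show ?thesis using i by (simp add: DERIV_imp_deriv if_distrib[of "(*) _"] cong: if_cong)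
  qed
  have g: "deriv (\<lambda>x. f (set_gen i j x Z)) (gens Z $$ (i, j)) = gens D $$ (i, j)"
    if ij: "i < n" "j < q" for i j
  proof -
    have "((\<lambda>x. f (set_gen i j x Z)) has_field_derivative
      (\<Sum>i'<n. center D $ i' * 0) +
      (\<Sum>i'<n. \<Sum>j'<q. gens D $$ (i', j') * (if i' = i \<and> j' = j then 1 else 0)))
      (at (gens Z $$ (i, j)))"
      using D Z ij
      by (intro has_zderivative_chain) (auto simp: set_gen_same dims)
    moreover have "(\<Sum>j'<q. gens D $$ (i', j') * (if i' = i \<and> j' = j then 1 else 0))
        = (if i' = i then gens D $$ (i, j) else 0)" for i'
      using ij by (cases "i' = i") (simp_all add: if_distrib[of "(*) _"] cong: if_cong)
    ultimately show ?thesis using ij by (simp add: DERIV_imp_deriv)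
  qed
  show ?thesis
    using c g Dc by (intro zonotope_eqI[of _ n q]) (auto simp: zgrad_def dims carrier_zono_def)
qed

text \<open>Turns the anonymous witness of total differentiability into the gradient; in the theorem
  this lets \<open>Gk\<close> itself serve as the derivative of the loss.\<close>

lemma zdifferentiable_has_zderivative:
  assumes "zdifferentiable f Z" "Z \<in> carrier_zono n q"
  shows "has_zderivative f (zgrad f Z) n q Z"
proof -
  obtain D where "has_zderivative f D n q Z"
    using assms(1) unfolding zdifferentiable_def has_zderivative_def Let_def carrier_zonoD[OF assms(2)]
    by blast
  then show ?thesis using has_zderivative_imp_zgrad assms(2) by simp
qed

subsection \<open>Image enclosure\<close>

lemma bounds_index:
  assumes "Z \<in> carrier_zono n p" "i < n"
  shows "lower_bounds Z $ i = center Z $ i - (\<Sum>j<p. \<bar>gens Z $$ (i, j)\<bar>)"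
    and "upper_bounds Z $ i = center Z $ i + (\<Sum>j<p. \<bar>gens Z $$ (i, j)\<bar>)"
  using assms carrier_zonoD[OF assms(1)]
  by (simp_all add: lower_bounds_def upper_bounds_def scalar_prod_def atLeast0LessThan)

text \<open>The interval bounds of dimension \<open>i\<close> read only the center entry and
  generator row of that dimension, and the three coefficients see the set only through these bounds.
  Hence a perturbation of one row leaves the coefficients of all other rows constant.\<close>

lemma enclosure_coeffs_cong:
  assumes "Z \<in> carrier_zono n p" "Z' \<in> carrier_zono n p" "i < n"
    and "center Z $ i = center Z' $ i" "\<And>j. j < p \<Longrightarrow> gens Z $$ (i, j) = gens Z' $$ (i, j)"
  shows "slope \<phi> i Z = slope \<phi> i Z'" "lower_error \<phi> i Z = lower_error \<phi> i Z'"
    "upper_error \<phi> i Z = upper_error \<phi> i Z'"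
proof -
  have *: "lower_bounds Z $ i = lower_bounds Z' $ i" "upper_bounds Z $ i = upper_bounds Z' $ i"
    using assms by (simp_all add: bounds_index)
  show s: "slope \<phi> i Z = slope \<phi> i Z'" by (simp add: slope_def *)
  show "lower_error \<phi> i Z = lower_error \<phi> i Z'" by (simp add: lower_error_def * s)
  show "upper_error \<phi> i Z = upper_error \<phi> i Z'" by (simp add: upper_error_def * s)
qed

section \<open>Entries of the enclosure and their derivatives\<close>

lemma mat_diag_mult_vec_index:
  assumes "v \<in> carrier_vec n" "i < n"
  shows "(mat_diag n m *\<^sub>v v) $ i = m i * (v $ i :: real)"
  using assms
  by (simp add: mat_diag_def scalar_prod_def if_distrib[of "\<lambda>x. x * _"] cong: if_cong)

lemma dim_center_enclose [simp]: "dim_vec (center (enclose \<phi> Z)) = dim_vec (center Z)"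
  by (simp add: enclose_def Let_def mat_diag_def)

lemma enclose_carrier:
  assumes "Z \<in> carrier_zono n p"
  shows "enclose \<phi> Z \<in> carrier_zono n (p + n)"
  using assms by (simp add: enclose_def carrier_zono_iff Let_def append_cols_def mat_diag_def)

lemma sum_up_split: "sum g {..<p + n} = sum g {..<p} + (\<Sum>j<n. g (p + j))" for g :: "nat \<Rightarrow> real"
  by (induction n) (simp_all add: add.assoc)

text \<open>The added columns form a diagonal block, so row \<open>i\<close> gets its error
  generator in column \<open>p + i\<close> and zeros in the other added columns. This is why the
  final formula uses just one gradient entry beyond the first \<open>p\<close>.\<close>

lemma enclose_index:
  assumes "Z \<in> carrier_zono n p" "i < n"
  shows "center (enclose \<phi> Z) $ i =
      slope \<phi> i Z * center Z $ i + (upper_error \<phi> i Z + lower_error \<phi> i Z) / 2"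
    and "j < p \<Longrightarrow> gens (enclose \<phi> Z) $$ (i, j) = slope \<phi> i Z * gens Z $$ (i, j)"
    and "j < n \<Longrightarrow> gens (enclose \<phi> Z) $$ (i, p + j) =
      (if j = i then (upper_error \<phi> i Z - lower_error \<phi> i Z) / 2 else 0)"
proof -
  have Z: "center Z \<in> carrier_vec n" "gens Z \<in> carrier_mat n p"
    using assms(1) by (auto simp: carrier_zono_def)
  show "center (enclose \<phi> Z) $ i =
      slope \<phi> i Z * center Z $ i + (upper_error \<phi> i Z + lower_error \<phi> i Z) / 2"
    using Z assms(2) by (simp add: enclose_def Let_def mat_diag_mult_vec_index)
  show "j < p \<Longrightarrow> gens (enclose \<phi> Z) $$ (i, j) = slope \<phi> i Z * gens Z $$ (i, j)"
    using Z assms(2) by (simp add: enclose_def Let_def append_cols_def mat_diag_mult_left)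
  show "j < n \<Longrightarrow> gens (enclose \<phi> Z) $$ (i, p + j) =
      (if j = i then (upper_error \<phi> i Z - lower_error \<phi> i Z) / 2 else 0)"
    using Z assms(2)
    by (auto simp: enclose_def Let_def append_cols_def mat_diag_mult_left mat_diag_def)
qed

text \<open>Stated for an arbitrary curve moving only row \<open>i\<close>, so that perturbing the
  center and perturbing a generator are two instances. The sum and the difference with column
  \<open>p + i\<close> arise because the error bounds enter the center through half their sum and
  the new generator through half their difference.\<close>

lemma enclose_chain:
  assumes f: "zdifferentiable f (enclose \<phi> Z)"
    and Z: "\<gamma> x0 = Z" and \<gamma>: "\<And>x. \<gamma> x \<in> carrier_zono n p" and i: "i < n"
    and const: "\<And>i' x. i' < n \<Longrightarrow> i' \<noteq> i \<Longrightarrow> center (\<gamma> x) $ i' = center Z $ i'"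
      "\<And>i' j x. i' < n \<Longrightarrow> i' \<noteq> i \<Longrightarrow> j < p \<Longrightarrow> gens (\<gamma> x) $$ (i', j) = gens Z $$ (i', j)"
    and dc: "((\<lambda>x. center (\<gamma> x) $ i) has_field_derivative dc) (at x0)"
    and dg: "\<And>j. j < p \<Longrightarrow> ((\<lambda>x. gens (\<gamma> x) $$ (i, j)) has_field_derivative dg j) (at x0)"
    and dm: "((\<lambda>x. slope \<phi> i (\<gamma> x)) has_field_derivative dm) (at x0)"
    and du: "((\<lambda>x. upper_error \<phi> i (\<gamma> x)) has_field_derivative du) (at x0)"
    and dl: "((\<lambda>x. lower_error \<phi> i (\<gamma> x)) has_field_derivative dl) (at x0)"
  defines "G \<equiv> zgrad f (enclose \<phi> Z)"
  shows "((\<lambda>x. f (enclose \<phi> (\<gamma> x))) has_field_derivative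
      slope \<phi> i Z * (center G $ i * dc + (\<Sum>j<p. gens G $$ (i, j) * dg j))
    + (center G $ i * center Z $ i + (\<Sum>j<p. gens G $$ (i, j) * gens Z $$ (i, j))) * dm
    + (1/2 * (center G $ i + gens G $$ (i, p + i))) * du
    + (1/2 * (center G $ i - gens G $$ (i, p + i))) * dl) (at x0)"
proof -
  note [simp] = Z
  have Zc: "Z \<in> carrier_zono n p" using \<gamma>[of x0] by simp
  let ?m = "slope \<phi> i Z"
  \<comment> \<open>Velocities of the center and of column \<open>j\<close> in row \<open>i\<close>
    of the enclosure: the product rule for slope times entry, and the halved error terms.\<close>
  define ec where "ec = dm * center Z $ i + ?m * dc + (du + dl) / 2"
  define eg where "eg j = (if j < p then dm * gens Z $$ (i, j) + ?m * dg j
    else if j = p + i then (du - dl) / 2 else 0)" for j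
  have G: "has_zderivative f G n (p + n) (enclose \<phi> Z)"
    unfolding G_def by (intro zdifferentiable_has_zderivative f enclose_carrier Zc)
  have coeffs: "slope \<phi> i' (\<gamma> x) = slope \<phi> i' Z"
      "upper_error \<phi> i' (\<gamma> x) = upper_error \<phi> i' Z"
      "lower_error \<phi> i' (\<gamma> x) = lower_error \<phi> i' Z" if "i' < n" "i' \<noteq> i" for i' x
    using enclosure_coeffs_cong[OF \<gamma> Zc that(1), of x] const that by simp_all
  have c: "((\<lambda>x. center (enclose \<phi> (\<gamma> x)) $ i') has_field_derivative (if i' = i then ec else 0)) (at x0)"
    if "i' < n" for i'
  proof (cases "i' = i")
    case True
    show ?thesis unfolding enclose_index(1)[OF \<gamma> that] unfolding True ec_def
      by (auto intro!: derivative_eq_intros dc dm du dl)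
  next
    case False
    then show ?thesis unfolding enclose_index(1)[OF \<gamma> that]
      using that by (simp add: coeffs[OF that False] const(1)[OF that False])
  qed
  have g: "((\<lambda>x. gens (enclose \<phi> (\<gamma> x)) $$ (i', j)) has_field_derivative (if i' = i then eg j else 0)) (at x0)"
    if "i' < n" "j < p + n" for i' j
  proof (cases "j < p")
    case j: True
    show ?thesis
    proof (cases "i' = i")
      case True
      show ?thesis unfolding enclose_index(2)[OF \<gamma> that(1) j] unfolding True eg_def
        using j by (auto intro!: derivative_eq_intros dg dm)
    next
      case False
      then show ?thesis unfolding enclose_index(2)[OF \<gamma> that(1) j]
        using that by (simp add: coeffs[OF that(1) False] const(2)[OF that(1) False j])
    qed
  next
    case False
    with that(2) have "j = p + (j - p)" "j - p < n" by auto
    then obtain j' where j: "j = p + j'" "j' < n" by blast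
    show ?thesis
    proof (cases "i' = i")
      case True
      show ?thesis unfolding j(1) enclose_index(3)[OF \<gamma> that(1) j(2)] unfolding True eg_def
        by (auto intro!: derivative_eq_intros du dl)
    next
      case False
      then show ?thesis unfolding j(1) enclose_index(3)[OF \<gamma> that(1) j(2)]
        using that by (cases "j' = i'") (simp_all add: coeffs[OF that(1) False])
    qed
  qed
  have d: "((\<lambda>x. f (enclose \<phi> (\<gamma> x))) has_field_derivative
      (\<Sum>i'<n. center G $ i' * (if i' = i then ec else 0))
      + (\<Sum>i'<n. \<Sum>j<p+n. gens G $$ (i', j) * (if i' = i then eg j else 0))) (at x0)"
    using has_zderivative_chain[of f G n "p + n" "\<lambda>x. enclose \<phi> (\<gamma> x)", OF _ enclose_carrier[OF \<gamma>] c g] G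
    by simp
  have center_sum: "(\<Sum>i'<n. center G $ i' * (if i' = i then ec else 0)) = center G $ i * ec"
    using i by (simp add: if_distrib[of "(*) _"] cong: if_cong)
  \<comment> \<open>All rows other than \<open>i\<close> are stationary, so the double sum collapses
    to one row.\<close>
  have row_sum: "(\<Sum>i'<n. \<Sum>j<p+n. gens G $$ (i', j) * (if i' = i then eg j else 0))
      = (\<Sum>j<p+n. gens G $$ (i, j) * eg j)"
  proof -
    have "(\<Sum>j<p+n. gens G $$ (i', j) * (if i' = i then eg j else 0))
      = (if i' = i then \<Sum>j<p+n. gens G $$ (i, j) * eg j else 0)" for i' by simp
    then show ?thesis using i by simp
  qed
  have split: "(\<Sum>j<p+n. gens G $$ (i, j) * eg j)
      = (\<Sum>j<p. gens G $$ (i, j) * eg j) + (\<Sum>j<n. gens G $$ (i, p + j) * eg (p + j))"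
    by (rule sum_up_split)
  \<comment> \<open>Among the added columns of row \<open>i\<close>, only column
    \<open>p + i\<close> moves.\<close>
  have errors: "(\<Sum>j<n. gens G $$ (i, p + j) * eg (p + j)) = gens G $$ (i, p + i) * ((du - dl) / 2)"
    using i by (simp add: eg_def if_distrib[of "(*) _"] cong: if_cong)
  have gens_sum: "(\<Sum>j<p. gens G $$ (i, j) * eg j)
      = (\<Sum>j<p. gens G $$ (i, j) * gens Z $$ (i, j)) * dm + ?m * (\<Sum>j<p. gens G $$ (i, j) * dg j)"
    by (simp add: eg_def sum.distrib sum_distrib_left sum_distrib_right algebra_simps)
  show ?thesis
    by (rule DERIV_cong[OF d], unfold center_sum row_sum split errors gens_sum)
      (simp add: ec_def algebra_simps add_divide_distrib diff_divide_distrib)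
qed

subsection \<open>Networks\<close>

text \<open>Peels off the outermost layer; this yields \<open>Hk\<close> as the enclosure of
  \<open>Hprev\<close>.\<close>

lemma propagate_last:
  assumes "j < k"
  shows "propagate N j k Z = layer_image (N k) (propagate N j (k - 1) Z)"
  using assms by (cases k) (auto simp: propagate_def)

text \<open>Supplies the center dimension of \<open>Hprev\<close>, whereas the theorem assumes the
  shape of its generator matrix directly.\<close>

lemma dim_center_propagate:
  assumes "\<And>j. 1 \<le> j \<Longrightarrow> j \<le> k \<Longrightarrow> layer_dims (n (j - 1)) (n j) (N j)"
    and "dim_vec (center Z) = n 0"
  shows "dim_vec (center (propagate N 0 k Z)) = n k"
  using assms(1)
proof (induction k)
  case 0
  then show ?case using assms(2) by (simp add: propagate_def)
next
  case (Suc k)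
  have "dim_vec (center (propagate N 0 k Z)) = n k" using Suc by simp
  moreover have "layer_dims (n k) (n (Suc k)) (N (Suc k))" using Suc.prems[of "Suc k"] by simp
  ultimately show ?case
    by (cases "N (Suc k)") (auto simp: propagate_last)
qed

text \<open>Peels off the innermost layer; this factors the loss as a function of the previous set
  through layer \<open>k\<close>.\<close>

lemma propagate_first:
  assumes "j < k"
  shows "propagate N j k Z = propagate N (Suc j) k (layer_image (N (Suc j)) Z)"
  using assms by (simp add: propagate_def upt_conv_Cons del: upt_Suc)

section \<open>The gradient set of the enclosure layer\<close>

lemma zproj_zgrad:
  assumes "Z \<in> carrier_zono n p" "i < n"
  shows "zproj i (zgrad f Z) = Zonotope
    (vec 1 (\<lambda>_. deriv (\<lambda>x. f (set_center i x Z)) (center Z $ i)))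
    (mat 1 p (\<lambda>(_, j). deriv (\<lambda>x. f (set_gen i j x Z)) (gens Z $$ (i, j))))"
  using assms carrier_zonoD[OF assms(1)]
  by (auto simp: zproj_def zgrad_def mat_of_row_def intro!: eq_vecI eq_matI)

theorem proposition12:
  fixes N :: "nat \<Rightarrow> layer" and n :: "nat \<Rightarrow> nat" and \<kappa> k p q i :: nat
    and \<phi> :: "real \<Rightarrow> real" and H0 Hprev Hk Gprev Gk :: zonotope
    and L :: "real vec \<Rightarrow> real vec \<Rightarrow> real" and \<tau> \<epsilon> :: real and t :: "real vec"
    and E :: "zonotope \<Rightarrow> real"
  assumes "\<And>j. 1 \<le> j \<Longrightarrow> j \<le> \<kappa> \<Longrightarrow> layer_dims (n (j - 1)) (n j) (N j)"
    and "H0 \<in> carrier_zono (n 0) q"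
    and "t \<in> carrier_vec (n \<kappa>)"
    and "0 \<le> \<tau>" "\<tau> \<le> 1" "0 < \<epsilon>"
    and "E = set_loss L \<tau> \<epsilon> t"
    and "1 \<le> k" "k \<le> \<kappa>"
    and "N k = Nonlinear \<phi>" and "mono \<phi>"
    and "Hprev = propagate N 0 (k - 1) H0"
    and "gens Hprev \<in> carrier_mat (n (k - 1)) p"
    and "Hk = propagate N 0 k H0"
    and "Gk = zgrad (\<lambda>Z. E (propagate N k \<kappa> Z)) Hk"
    and "Gprev = zgrad (\<lambda>Z. E (propagate N (k - 1) \<kappa> Z)) Hprev"
    and "i < n k"
    \<comment> \<open>differentiability presupposed by the gradients in the formula\<close>
    and "zdifferentiable (\<lambda>Z. E (propagate N k \<kappa> Z)) Hk"
    and "has_zgrad_row i (slope \<phi> i) Hprev"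
    and "has_zgrad_row i (upper_error \<phi> i) Hprev"
    and "has_zgrad_row i (lower_error \<phi> i) Hprev"
  shows "has_zgrad_row i (\<lambda>Z. E (propagate N (k - 1) \<kappa> Z)) Hprev \<and>
    zproj i Gprev =
        slope \<phi> i Hprev *\<^sub>R zproj_first p i Gk
      + (center Gk $ i * center Hprev $ i
           + vec_first (row (gens Gk) i) p \<bullet> row (gens Hprev) i)
          *\<^sub>R zgrad_row i (slope \<phi> i) Hprev
      + (1/2 * (center Gk $ i + gens Gk $$ (i, p + i))) *\<^sub>R zgrad_row i (upper_error \<phi> i) Hprev
      + (1/2 * (center Gk $ i - gens Gk $$ (i, p + i))) *\<^sub>R zgrad_row i (lower_error \<phi> i) Hprev"
proof -
  let ?F = "\<lambda>Z. E (propagate N k \<kappa> Z)"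
  let ?P = "\<lambda>Z. E (propagate N (k - 1) \<kappa> Z)"
  let ?n = "n k"
  note [simp] = assms(10)
  \<comment> \<open>A nonlinear layer preserves the dimension, so \<open>i < n k\<close> is also a
    valid row of \<open>Hprev\<close>.\<close>
  have n_eq: "n (k - 1) = ?n" using assms(1)[of k] assms(8,9) by simp
  have "dim_vec (center Hprev) = ?n"
    using dim_center_propagate[of "k - 1" n N H0] assms(1,2,9,12) n_eq
    by (simp add: carrier_zono_iff)
  then have Hprev: "Hprev \<in> carrier_zono ?n p"
    using assms(13) n_eq by (simp add: carrier_zono_iff)
  note dims = carrier_zonoD[OF Hprev]
  have Hk: "Hk = enclose \<phi> Hprev" using assms(8,12,14) by (simp add: propagate_last)
  have P: "?P Z = ?F (enclose \<phi> Z)" for Z using propagate_first[of "k - 1" \<kappa> N Z] assms(8,9) by simp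
  have Gk: "Gk = zgrad ?F (enclose \<phi> Hprev)" using assms(15) Hk by simp
  have F: "zdifferentiable ?F (enclose \<phi> Hprev)" using assms(18) Hk by simp
  have "Gk \<in> carrier_zono ?n (p + ?n)"
    using zdifferentiable_has_zderivative[OF F enclose_carrier[OF Hprev]]
    by (simp add: has_zderivative_def Gk)
  note Gk_dims = carrier_zonoD[OF this]
  \<comment> \<open>The factor of the slope gradient, in the summation form produced by
    \<open>enclose_chain\<close>; the next fact matches it with the scalar product in the
    statement.\<close>
  define s where "s = center Gk $ i * center Hprev $ i + (\<Sum>j<p. gens Gk $$ (i, j) * gens Hprev $$ (i, j))"
  have s: "center Gk $ i * center Hprev $ i + vec_first (row (gens Gk) i) p \<bullet> row (gens Hprev) i = s"
    using assms(17)
    by (simp add: s_def scalar_prod_def vec_first_def dims Gk_dims atLeast0LessThan)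
  let ?u = "1/2 * (center Gk $ i + gens Gk $$ (i, p + i))"
  let ?l = "1/2 * (center Gk $ i - gens Gk $$ (i, p + i))"
  let ?dc = "\<lambda>f. deriv (\<lambda>x. f (set_center i x Hprev)) (center Hprev $ i)"
  let ?dg = "\<lambda>j f. deriv (\<lambda>x. f (set_gen i j x Hprev)) (gens Hprev $$ (i, j))"
  have dc: "((\<lambda>x. f (set_center i x Hprev)) has_field_derivative ?dc f) (at (center Hprev $ i))"
    and dg: "j < p \<Longrightarrow> ((\<lambda>x. f (set_gen i j x Hprev)) has_field_derivative ?dg j f) (at (gens Hprev $$ (i, j)))"
    if "has_zgrad_row i f Hprev" for f j
    using that by (auto simp: has_zgrad_row_def DERIV_deriv_iff_field_differentiable dims)
  \<comment> \<open>Moving the center entry means velocity 1 in the center and 0 in every generator,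
    which leaves only the center entry of \<open>Gk\<close> in the slope term.\<close>
  have c: "((\<lambda>x. ?P (set_center i x Hprev)) has_field_derivative
      slope \<phi> i Hprev * center Gk $ i + s * ?dc (slope \<phi> i)
      + ?u * ?dc (upper_error \<phi> i) + ?l * ?dc (lower_error \<phi> i)) (at (center Hprev $ i))"
    unfolding P
    by (rule DERIV_cong[OF enclose_chain[where p = p and dc = 1 and dg = "\<lambda>_. 0", OF F _ _ assms(17) _ _ _ _
            dc[OF assms(19)] dc[OF assms(20)] dc[OF assms(21)]]])
      (use Hprev assms(17) in \<open>simp_all add: set_center_same dims s_def flip: Gk\<close>)
  \<comment> \<open>Here the center is fixed and the generator velocity is a Kronecker delta, which
    selects entry \<open>j\<close> of row \<open>i\<close> of \<open>Gk\<close>.\<close>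
  have g: "((\<lambda>x. ?P (set_gen i j x Hprev)) has_field_derivative
      slope \<phi> i Hprev * gens Gk $$ (i, j) + s * ?dg j (slope \<phi> i)
      + ?u * ?dg j (upper_error \<phi> i) + ?l * ?dg j (lower_error \<phi> i)) (at (gens Hprev $$ (i, j)))"
    if j: "j < p" for j
  proof -
    have sum: "(\<Sum>j'<p. gens Gk $$ (i, j') * (if j' = j then 1 else 0)) = gens Gk $$ (i, j)"
      using j by (simp add: if_distrib cong: if_cong)
    show ?thesis
      unfolding P
      by (rule DERIV_cong[OF enclose_chain[where p = p and dc = 0 and dg = "\<lambda>j'. if j' = j then 1 else 0",
              OF F _ _ assms(17) _ _ _ _ dg[OF assms(19) j] dg[OF assms(20) j] dg[OF assms(21) j]]])
        (use Hprev assms(17) in \<open>simp_all add: set_gen_same dims sum s_def flip: Gk\<close>)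
  qed
  \<comment> \<open>\<open>c\<close> and \<open>g\<close> first give existence of the partial
    derivatives of the loss; their values then give the formula by comparing entries, since all four
    terms on the right share the same coefficients in the center and in each of the \<open>p\<close>
    columns.\<close>
  have "has_zgrad_row i ?P Hprev"
    using c g by (auto simp: has_zgrad_row_def dims field_differentiable_def)
  moreover have "zproj i Gprev = slope \<phi> i Hprev *\<^sub>R zproj_first p i Gk
      + s *\<^sub>R zgrad_row i (slope \<phi> i) Hprev + ?u *\<^sub>R zgrad_row i (upper_error \<phi> i) Hprev
      + ?l *\<^sub>R zgrad_row i (lower_error \<phi> i) Hprev"
    unfolding assms(16) zgrad_row_def zproj_zgrad[OF Hprev assms(17)]
    using assms(17) DERIV_imp_deriv[OF c] DERIV_imp_deriv[OF g]
    by (auto simp: plus_zonotope_def scaleR_zonotope_def zproj_first_def mat_of_row_def vec_first_def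
        Gk_dims intro!: eq_vecI eq_matI)
  ultimately show ?thesis unfolding s by blast
qed

end
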